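(* Let $\mathfrak{T}\subseteq\mathrm{AO}(N)$ be a closed subset, assume that $A_K^{t,\Phi}$ is $\mathfrak{T}$-admissible (i.e. multiplicative on $\mathfrak{T}$), and let $L$ be a left ideal of $A$. Then the set $\{\mathrm{LM}_\preceq(L)\mid{\preceq}\in\mathfrak{T}\}$ is finite. In particular, if $A_K^{t,\Phi}$ is admissible (i.e. multiplicative on $\mathrm{AO}(N)$), then the nonempty set $\{\mathrm{LM}_\preceq(L)\mid{\preceq}\in\mathrm{AO}(N)\}$ is finite.
   Context: An algebra of countable type $A_K^{t,\Phi}=(A,K,t,\Phi)$ consists of an associative unital, not necessarily commutative algebra $A$ over a field $K$, a nonnegative integer $t$, and a $K$-module isomorphism $\Phi:A\to K[X]=K[X_1,\dots,X_t]$ (commutative polynomial ring; $\Phi$ need not be multiplicative). $M=\{X^\nu\mid\nu\in\mathbb{N}_0^t\}$ is the set of monomials and $N=\Phi^{-1}(M)$ is the canonical $K$-basis of $A$. For a set $S$, $\mathrm{TO}(S)$ is the set of all total orderings on $S$ (antisymmetric, transitive, total binary relations), with the coarsest topology for which all sets $\mathfrak{U}_{(a,b)}=\{{\preceq}\in\mathrm{TO}(S)\mid a\preceq b\}$ are open; subsets carry the relative topology. Let $\phi:\mathrm{TO}(N)\to\mathrm{TO}(M)$ be the bijection given by $\Phi(n)\,\phi({\preceq})\,\Phi(n')\Leftrightarrow n\preceq n'$. For ${\preceq}\in\mathrm{TO}(N)$ and $a\in A\setminus\{0\}$, $\mathrm{LM}_\preceq(a)\in M$ is the $\phi({\preceq})$-maximal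 monomial occurring in $\Phi(a)$ with nonzero coefficient. For $H\subseteq A$, $\mathrm{LM}_\preceq(H)$ is the ideal of $K[X]$ generated by $\{\mathrm{LM}_\preceq(h)\mid h\in H\setminus\{0\}\}$. For $\mathfrak{T}\subseteq\mathrm{TO}(N)$, $A_K^{t,\Phi}$ is multiplicative on $\mathfrak{T}$ if $A$ is a domain and $\mathrm{LM}_\preceq(ab)=\mathrm{LM}_\preceq(a)\mathrm{LM}_\preceq(b)$ for all $a,b\in A\setminus\{0\}$ and all ${\preceq}\in\mathfrak{T}$. $\mathrm{AO}(M)$ is the set of admissible orderings on $M$: those ${\leq}\in\mathrm{TO}(M)$ with $1\leq X^\nu$ for all $\nu$ and $X^\upsilon\leq X^\nu\Rightarrow X^{\upsilon+\gamma}\leq X^{\nu+\gamma}$ for all $\upsilon,\nu,\gamma\in\mathbb{N}_0^t$. $\mathrm{AO}(N)=\phi^{-1}(\mathrm{AO}(M))$. *)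

theory Defs
  imports "HOL-Analysis.Abstract_Topology" "HOL-Library.Poly_Mapping" "HOL-Algebra.Ideal"
begin

text \<open>
  A polynomial over \<open>'k\<close> is a finitely supported function from exponents to coefficients.
  Exponents have type \<^typ>\<open>nat \<Rightarrow>\<^sub>0 nat\<close>, which allows infinitely many variables; the \<open>t\<close> variables
  of the polynomial ring are those with index below \<open>t\<close>, so that \<open>t = 0\<close> is possible.
\<close>

type_synonym 'k mpoly = "(nat \<Rightarrow>\<^sub>0 nat) \<Rightarrow>\<^sub>0 'k"

definition exponents :: "nat \<Rightarrow> (nat \<Rightarrow>\<^sub>0 nat) set" where
  "exponents t = {\<nu>. Poly_Mapping.keys \<nu> \<subseteq> {..<t}}"

definition polys :: "nat \<Rightarrow> 'k::field mpoly set" where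
  "polys t = {p. Poly_Mapping.keys p \<subseteq> exponents t}"

definition poly_ring :: "nat \<Rightarrow> 'k::field mpoly ring" where
  "poly_ring t = \<lparr>carrier = polys t, monoid.mult = (*), one = 1, zero = 0, add = (+)\<rparr>"

definition poly_scale :: "'k::field \<Rightarrow> 'k mpoly \<Rightarrow> 'k mpoly" where
  "poly_scale c p = Poly_Mapping.map ((*) c) p"

lemma lookup_poly_scale: "Poly_Mapping.lookup (poly_scale c p) \<nu> = c * Poly_Mapping.lookup p \<nu>"
  by (simp add: poly_scale_def map.rep_eq when_def)

lemma vector_space_poly_scale: "vector_space (poly_scale :: 'k::field \<Rightarrow> _)"
  by unfold_locales
     (auto simp: lookup_poly_scale lookup_add algebra_simps intro!: poly_mapping_eqI)

lemma exponents_add: "a \<in> exponents t \<Longrightarrow> b \<in> exponents t \<Longrightarrow> a + b \<in> exponents t"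
  unfolding exponents_def using keys_add[of a b] by auto

lemma cring_poly_ring: "cring (poly_ring t :: 'k::field mpoly ring)"
proof -
  have add: "p + q \<in> polys t" if "p \<in> polys t" "q \<in> polys t" for p q :: "'k mpoly"
    using that keys_add[of p q] unfolding polys_def by auto
  have mult: "p * q \<in> polys t" if "p \<in> polys t" "q \<in> polys t" for p q :: "'k mpoly"
    using that keys_mult[of p q] exponents_add unfolding polys_def by fastforce
  have "- p \<in> polys t" if "p \<in> polys t" for p :: "'k mpoly"
    using that unfolding polys_def by simp
  then have inv: "\<exists>q \<in> polys t. p + q = 0" if "p \<in> polys t" for p :: "'k mpoly"
    using that by (intro bexI[of _ "- p"]) auto
  have const: "0 \<in> polys t" "1 \<in> (polys t :: 'k mpoly set)"
    unfolding polys_def exponents_def by (simp_all flip: single_one)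
  show ?thesis
    by (intro cringI abelian_groupI comm_monoidI)
       (auto simp: poly_ring_def add mult inv const algebra_simps)
qed

definition X_pow :: "(nat \<Rightarrow>\<^sub>0 nat) \<Rightarrow> 'k::field mpoly" where
  "X_pow \<nu> = Poly_Mapping.single \<nu> 1"

definition monomials :: "nat \<Rightarrow> 'k::field mpoly set" where
  "monomials t = X_pow ` exponents t"

definition occurring_monomials :: "'k::field mpoly \<Rightarrow> 'k mpoly set" where
  "occurring_monomials p = X_pow ` Poly_Mapping.keys p"

text \<open>
  The class \<^class>\<open>ring_1\<close> makes \<open>A\<close> nonzero, which is no restriction as \<open>A\<close> is isomorphic to a
  polynomial ring over a field.  The isomorphism \<open>\<Phi>\<close> is one of vector spaces only.
\<close>

locale countable_type_algebra =
  fixes scale :: "'k::field \<Rightarrow> 'a::ring_1 \<Rightarrow> 'a"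
    and t :: nat
    and \<Phi> :: "'a \<Rightarrow> 'k mpoly"
  assumes vector_space_scale: "vector_space scale"
    and scale_mult_left: "scale c a * b = scale c (a * b)"
    and scale_mult_right: "a * scale c b = scale c (a * b)"
    and linear_Phi: "Vector_Spaces.linear scale poly_scale \<Phi>"
    and bij_Phi: "bij_betw \<Phi> UNIV (polys t)"

definition canonical_basis :: "nat \<Rightarrow> ('a \<Rightarrow> 'k::field mpoly) \<Rightarrow> 'a set" where
  "canonical_basis t \<Phi> = \<Phi> -` monomials t"

definition TO :: "'s set \<Rightarrow> 's rel set" where
  "TO S = {r. linear_order_on S r}"

text \<open>
  The set \<^term>\<open>TO S\<close> is added to the subbasis because the sets \<open>{r \<in> TO S. (a, b) \<in> r}\<close> do not
  cover \<^term>\<open>TO S\<close> if \<open>S\<close> is empty.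
\<close>

definition TO_topology :: "'s set \<Rightarrow> 's rel topology" where
  "TO_topology S =
     topology_generated_by (insert (TO S) {{r \<in> TO S. (a, b) \<in> r} | a b. a \<in> S \<and> b \<in> S})"

lemma topspace_TO_topology: "topspace (TO_topology S) = TO S"
  unfolding TO_topology_def by auto

definition transfer_order :: "('a \<Rightarrow> 'k::field mpoly) \<Rightarrow> 'a rel \<Rightarrow> 'k mpoly rel" where
  "transfer_order \<Phi> r = {(\<Phi> n, \<Phi> n') | n n'. (n, n') \<in> r}"

definition AO_monomials :: "nat \<Rightarrow> 'k::field mpoly rel set" where
  "AO_monomials t = {r \<in> TO (monomials t).
     (\<forall>\<nu> \<in> exponents t. (1, X_pow \<nu>) \<in> r) \<and>
     (\<forall>\<upsilon> \<in> exponents t. \<forall>\<nu> \<in> exponents t. \<forall>\<gamma> \<in> exponents t.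
        (X_pow \<upsilon>, X_pow \<nu>) \<in> r \<longrightarrow> (X_pow (\<upsilon> + \<gamma>), X_pow (\<nu> + \<gamma>)) \<in> r)}"

definition AO :: "nat \<Rightarrow> ('a \<Rightarrow> 'k::field mpoly) \<Rightarrow> 'a rel set" where
  "AO t \<Phi> = {r \<in> TO (canonical_basis t \<Phi>). transfer_order \<Phi> r \<in> AO_monomials t}"

text \<open>Only meaningful for \<open>a \<noteq> 0\<close>, when \<open>\<Phi> a\<close> has at least one occurring monomial.\<close>

definition LM :: "('a \<Rightarrow> 'k::field mpoly) \<Rightarrow> 'a rel \<Rightarrow> 'a \<Rightarrow> 'k mpoly" where
  "LM \<Phi> r a = (THE m. m \<in> occurring_monomials (\<Phi> a) \<and>
     (\<forall>m' \<in> occurring_monomials (\<Phi> a). (m', m) \<in> transfer_order \<Phi> r))"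

definition LM_ideal ::
    "nat \<Rightarrow> ('a::zero \<Rightarrow> 'k::field mpoly) \<Rightarrow> 'a rel \<Rightarrow> 'a set \<Rightarrow> 'k mpoly set" where
  "LM_ideal t \<Phi> r H = genideal (poly_ring t) (LM \<Phi> r ` (H - {0}))"

text \<open>The first conjunct says that the noncommutative ring \<open>A\<close> is a domain.\<close>

definition multiplicative_on :: "('a::ring_1 \<Rightarrow> 'k::field mpoly) \<Rightarrow> 'a rel set \<Rightarrow> bool" where
  "multiplicative_on \<Phi> \<TT> \<longleftrightarrow>
     (\<forall>a b :: 'a. a \<noteq> 0 \<longrightarrow> b \<noteq> 0 \<longrightarrow> a * b \<noteq> 0) \<and>
     (\<forall>r \<in> \<TT>. \<forall>a b. a \<noteq> 0 \<longrightarrow> b \<noteq> 0 \<longrightarrow> LM \<Phi> r (a * b) = LM \<Phi> r a * LM \<Phi> r b)"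

definition left_ideal :: "'a::ring_1 set \<Rightarrow> bool" where
  "left_ideal L \<longleftrightarrow> 0 \<in> L \<and> (\<forall>x \<in> L. \<forall>y \<in> L. x + y \<in> L) \<and> (\<forall>a. \<forall>x \<in> L. a * x \<in> L)"

end

theory Submission
  imports Defs "HOL-Library.Countable_Set"
begin

text \<open>
  The ideal \<open>LM\<^sub>\<preceq>(L)\<close> is determined by the set of exponents of leading monomials of elements of \<open>L\<close>,
  and by Dickson's lemma finitely many elements \<open>G\<close> of \<open>L\<close> generate this set. If another ordering
  \<open>\<preceq>'\<close> agrees with \<open>\<preceq>\<close> on the finitely many basis elements occurring in \<open>G\<close>, then \<open>G\<close> has the same
  leading monomials for \<open>\<preceq>'\<close>, and reduction modulo \<open>G\<close> shows \<open>LM\<^sub>\<preceq>'(L) = LM\<^sub>\<preceq>(L)\<close>. Thus \<open>LM\<^sub>\<preceq>(L)\<close> depends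
  on \<open>\<preceq>\<close> in a locally constant way. Were there infinitely many values, then deciding the
  countably many comparisons one after the other, always keeping infinitely many values, would
  produce a limit ordering near which the ideal is not constant.
\<close>

subsection \<open>Dickson's lemma\<close>

text \<open>A decreasing sequence of naturals is constant from the index where it attains its
  minimum. Hence a decreasing subsequence becomes increasing once its start is dropped.\<close>

lemma incseq_subsequence_nat:
  fixes s :: "nat \<Rightarrow> nat"
  shows "\<exists>g :: nat \<Rightarrow> nat. strict_mono g \<and> incseq (\<lambda>n. s (g n))"
proof -
  obtain g :: "nat \<Rightarrow> nat" where g: "strict_mono g" "monoseq (\<lambda>n. s (g n))"
    using seq_monosub by blast
  show ?thesis
  proof (cases "incseq (\<lambda>n. s (g n))")
    case True
    then show ?thesis using g(1) by blast
  next
    case False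
    then have dec: "decseq (\<lambda>n. s (g n))" using g(2) by (simp add: monoseq_iff)
    obtain m where m: "\<And>n. s (g m) \<le> s (g n)"
      using ex_has_least_nat[of "\<lambda>_. True" 0 "\<lambda>n. s (g n)"] by auto
    have "s (g (n + m)) = s (g m)" for n
      using m[of "n + m"] decseqD[OF dec, of m "n + m"] by simp
    moreover have "strict_mono (\<lambda>n. g (n + m))"
      using g(1) by (simp add: strict_mono_def)
    ultimately show ?thesis
      by (intro exI[of _ "\<lambda>n. g (n + m)"]) (simp add: incseq_def)
  qed
qed

text \<open>The sequence is thinned out once per index; what is already increasing stays so along a
  further subsequence.\<close>

lemma common_incseq_subsequence_nat:
  fixes s :: "'i \<Rightarrow> nat \<Rightarrow> nat"
  assumes "finite I"
  shows "\<exists>g :: nat \<Rightarrow> nat. strict_mono g \<and> (\<forall>i\<in>I. incseq (\<lambda>n. s i (g n)))"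
  using assms
proof induction
  case empty
  have "strict_mono (\<lambda>n :: nat. n)" by (simp add: strict_mono_def)
  then show ?case by blast
next
  case (insert i I)
  then obtain g :: "nat \<Rightarrow> nat" where g: "strict_mono g" "\<forall>i\<in>I. incseq (\<lambda>n. s i (g n))"
    by blast
  obtain g' :: "nat \<Rightarrow> nat" where g': "strict_mono g'" "incseq (\<lambda>n. s i (g (g' n)))"
    using incseq_subsequence_nat[of "\<lambda>n. s i (g n)"] by blast
  have "incseq (\<lambda>n. s j (g (g' n)))" if "j \<in> I" for j
    using g(2) g'(1) that by (simp add: incseq_def strict_mono_less_eq)
  moreover have "strict_mono (\<lambda>n. g (g' n))"
    using g(1) g'(1) by (simp add: strict_mono_def)
  ultimately show ?case using g'(2) by (intro exI[of _ "\<lambda>n. g (g' n)"]) auto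
qed

text \<open>Along a subsequence on which all \<open>t\<close> coordinates increase, the first two
  terms are already such a pair.\<close>

lemma dickson_good_pair:
  assumes "\<And>n :: nat. f n \<in> exponents t"
  shows "\<exists>i j. i < j \<and> (\<exists>w\<in>exponents t. f j = f i + w)"
proof -
  obtain g :: "nat \<Rightarrow> nat"
    where g: "strict_mono g" "\<forall>i\<in>{..<t}. incseq (\<lambda>n. Poly_Mapping.lookup (f (g n)) i)"
    using common_incseq_subsequence_nat[of "{..<t}" "\<lambda>i n. Poly_Mapping.lookup (f n) i"] by auto
  have out: "Poly_Mapping.lookup (f n) i = 0" if "\<not> i < t" for n i
    using assms[of n] that unfolding exponents_def by (auto simp: in_keys_iff)
  \<comment> \<open>Subtraction of exponents is truncated in each coordinate; \<open>le\<close>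
    makes this a true difference.\<close>
  define w where "w = f (g 1) - f (g 0)"
  have le: "Poly_Mapping.lookup (f (g 0)) i \<le> Poly_Mapping.lookup (f (g 1)) i" for i
    using g(2) out by (cases "i < t") (auto simp: incseq_def)
  have "f (g 1) = f (g 0) + w"
    using le by (intro poly_mapping_eqI) (simp add: w_def lookup_add lookup_minus)
  moreover have "w \<in> exponents t"
    unfolding exponents_def w_def using out
    by (auto simp: in_keys_iff lookup_minus intro: ccontr)
  moreover have "g 0 < g 1" using g(1) by (simp add: strict_mono_def)
  ultimately show ?thesis by blast
qed

lemma zero_in_exponents: "0 \<in> exponents t"
  unfolding exponents_def by simp

text \<open>\<open>F\<close> consists of the elements of \<open>V\<close> minimal for divisibility.
  No two distinct ones divide each other, so \<open>F\<close> is finite by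
  \<open>dickson_good_pair\<close>; induction on the total degree puts every element of
  \<open>V\<close> above a minimal one.\<close>

lemma dickson_finite_basis:
  assumes "V \<subseteq> exponents t"
  shows "\<exists>F. finite F \<and> F \<subseteq> V \<and> (\<forall>v\<in>V. \<exists>u\<in>F. \<exists>w\<in>exponents t. v = u + w)"
proof -
  define F where "F = {v \<in> V. \<forall>u\<in>V. \<forall>w\<in>exponents t. v = u + w \<longrightarrow> w = 0}"
  have "finite F"
  proof (rule ccontr)
    assume "infinite F"
    then obtain f :: "nat \<Rightarrow> _" where f: "inj f" "range f \<subseteq> F"
      using infinite_countable_subset by blast
    then obtain i j w where "i < j" "w \<in> exponents t" "f j = f i + w"
      using dickson_good_pair[of f t] assms unfolding F_def by blast
    moreover have "f i \<in> V" "f j \<in> F" using f(2) unfolding F_def by auto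
    ultimately have "f j = f i" unfolding F_def by auto
    then show False using \<open>i < j\<close> f(1) by (auto dest: injD)
  qed
  define deg where "deg v = (\<Sum>i<t. Poly_Mapping.lookup v i)" for v :: "nat \<Rightarrow>\<^sub>0 nat"
  have deg_add: "deg (u + w) = deg u + deg w" for u w
    by (simp add: deg_def lookup_add sum.distrib)
  have deg_pos: "deg w > 0" if "w \<in> exponents t" "w \<noteq> 0" for w
  proof -
    obtain i where "i \<in> Poly_Mapping.keys w" using \<open>w \<noteq> 0\<close> by fastforce
    then have "i < t" "Poly_Mapping.lookup w i \<noteq> 0"
      using that(1) unfolding exponents_def in_keys_iff[symmetric] by auto
    then show ?thesis unfolding deg_def by (intro sum_pos2[of _ i]) auto
  qed
  have "\<exists>u\<in>F. \<exists>w\<in>exponents t. v = u + w" if "v \<in> V" for v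
    using that
  proof (induction "deg v" arbitrary: v rule: less_induct)
    case less
    show ?case
    proof (cases "v \<in> F")
      case True
      then show ?thesis using zero_in_exponents by force
    next
      case False
      then obtain u w where u: "u \<in> V" "w \<in> exponents t" "v = u + w" "w \<noteq> 0"
        using less.prems unfolding F_def by blast
      then obtain u' w' where "u' \<in> F" "w' \<in> exponents t" "u = u' + w'"
        using less.hyps[of u] deg_add deg_pos by auto
      then show ?thesis using u exponents_add by (metis add.assoc)
    qed
  qed
  then show ?thesis using \<open>finite F\<close> unfolding F_def by blast
qed

text \<open>An exponent is determined by the list of its first \<open>t\<close> entries.\<close>

lemma countable_exponents: "countable (exponents t)"
proof (rule countableI')
  have "v = w" if "v \<in> exponents t" "w \<in> exponents t"
    and "map (Poly_Mapping.lookup v) [0..<t] = map (Poly_Mapping.lookup w) [0..<t]" for v w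
  proof (rule poly_mapping_eqI)
    fix i
    show "Poly_Mapping.lookup v i = Poly_Mapping.lookup w i"
    proof (cases "i < t")
      case True
      then show ?thesis using that(3) by auto
    next
      case False
      then have "i \<notin> Poly_Mapping.keys v" "i \<notin> Poly_Mapping.keys w"
        using that(1,2) unfolding exponents_def by auto
      then show ?thesis by (simp add: in_keys_iff)
    qed
  qed
  then show "inj_on (\<lambda>v. map (Poly_Mapping.lookup v) [0..<t]) (exponents t)"
    by (rule inj_onI)
qed

lemma finite_linear_order_max:
  assumes "linear_order_on A r" "finite X" "X \<noteq> {}" "X \<subseteq> A"
  shows "\<exists>m\<in>X. \<forall>x\<in>X. (x, m) \<in> r"
  using assms(2-4)
proof (induction rule: finite_ne_induct)
  case (singleton x)
  then show ?case using assms(1) unfolding order_on_defs refl_on_def by auto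
next
  case (insert x X)
  then obtain m where m: "m \<in> X" "\<forall>y\<in>X. (y, m) \<in> r" by auto
  have "refl_on A r" "trans r" "total_on A r" using assms(1) unfolding order_on_defs by auto
  then show ?case using insert.prems m unfolding refl_on_def total_on_def
    by (metis insert_iff insert_subset subsetD transD)
qed

subsection \<open>A compactness principle\<close>

text \<open>Compactness of the space of subsets of a countable set, proved in the manner of Koenig's
  lemma. The hypothesis concerns each \<open>q\<close> that members of \<open>T\<close> approximate
  on all finite subsets of \<open>C\<close>. It compares values of \<open>f\<close> on
  \<open>T\<close> only, so \<open>q\<close> itself may lie outside \<open>T\<close>.\<close>

lemma finite_image_if_locally_constant_at_limits:
  fixes T :: "'b set set" and f :: "'b set \<Rightarrow> 'c"
  assumes "countable C"
    and locally_constant: "\<And>q. q \<subseteq> C \<Longrightarrow>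
      (\<And>F. finite F \<Longrightarrow> F \<subseteq> C \<Longrightarrow> \<exists>r\<in>T. r \<inter> F = q \<inter> F) \<Longrightarrow>
      \<exists>F. finite F \<and> F \<subseteq> C \<and> (\<forall>r\<in>T. \<forall>r'\<in>T. r \<inter> F = q \<inter> F \<longrightarrow> r' \<inter> F = q \<inter> F \<longrightarrow> f r = f r')"
  shows "finite (f ` T)"
proof (rule ccontr)
  assume "infinite (f ` T)"
  define e where "e = from_nat_into C"
  have e: "C \<subseteq> range e" unfolding e_def using assms(1) by (rule subset_range_from_nat_into)
  have "\<exists>S. \<forall>n. (S n \<subseteq> T \<and> infinite (f ` S n)) \<and>
     (S (Suc n) \<subseteq> S n \<and> (\<forall>r\<in>S (Suc n). \<forall>r'\<in>S (Suc n). e n \<in> r \<longleftrightarrow> e n \<in> r'))"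
  proof (rule dependent_nat_choice)
    show "\<exists>S. S \<subseteq> T \<and> infinite (f ` S)" using \<open>infinite (f ` T)\<close> by blast
  next
    fix S n
    assume S: "S \<subseteq> T \<and> infinite (f ` S)"
    let ?P = "{r \<in> S. e n \<in> r}" and ?Q = "{r \<in> S. e n \<notin> r}"
    have "f ` S = f ` ?P \<union> f ` ?Q" by auto
    then have "infinite (f ` ?P) \<or> infinite (f ` ?Q)" using S by (metis finite_UnI)
    then show "\<exists>S'. (S' \<subseteq> T \<and> infinite (f ` S')) \<and>
        (S' \<subseteq> S \<and> (\<forall>r\<in>S'. \<forall>r'\<in>S'. e n \<in> r \<longleftrightarrow> e n \<in> r'))"
    proof
      assume "infinite (f ` ?P)"
      then show ?thesis using S by (intro exI[of _ ?P]) auto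
    next
      assume "infinite (f ` ?Q)"
      then show ?thesis using S by (intro exI[of _ ?Q]) auto
    qed
  qed
  then obtain S where S: "\<And>n. S n \<subseteq> T" "\<And>n. infinite (f ` S n)" "\<And>n. S (Suc n) \<subseteq> S n"
    and agree: "\<And>n r r'. r \<in> S (Suc n) \<Longrightarrow> r' \<in> S (Suc n) \<Longrightarrow> e n \<in> r \<longleftrightarrow> e n \<in> r'"
    by metis
  have antimono: "S n \<subseteq> S m" if "m \<le> n" for m n
    using lift_Suc_antimono_le[of S m n] S(3) that by blast
  have nonempty: "S n \<noteq> {}" for n using S(2)[of n] by auto
  \<comment> \<open>The limit gathers the positive decisions. As \<open>e\<close> may repeat points,
    \<open>decided\<close> checks that decisions at different stages agree, through a member common
    to both stages.\<close>
  define q where "q = {x \<in> C. \<exists>n. \<exists>r\<in>S (Suc n). e n = x \<and> x \<in> r}"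
  have decided: "x \<in> r \<longleftrightarrow> x \<in> q" if "r \<in> S (Suc n)" "x = e n" "x \<in> C" for r n x
  proof
    assume "x \<in> r"
    then show "x \<in> q" using that nonempty unfolding q_def by blast
  next
    assume "x \<in> q"
    then obtain m r' where r': "e m = x" "r' \<in> S (Suc m)" "x \<in> r'" unfolding q_def by blast
    obtain r'' where r'': "r'' \<in> S (Suc (max m n))" using nonempty by blast
    then have "r'' \<in> S (Suc m)" "r'' \<in> S (Suc n)"
      using antimono[of "Suc m" "Suc (max m n)"] antimono[of "Suc n" "Suc (max m n)"] by auto
    then show "x \<in> r" using agree r' that by metis
  qed
  have eventually: "\<exists>n. \<forall>r\<in>S n. r \<inter> F = q \<inter> F" if "finite F" "F \<subseteq> C" for F
    using that
  proof induction
    case empty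
    then show ?case by simp
  next
    case (insert x F)
    then obtain n where n: "\<forall>r\<in>S n. r \<inter> F = q \<inter> F" by auto
    obtain m where m: "x = e m" using insert.prems e by auto
    have "r \<inter> insert x F = q \<inter> insert x F" if "r \<in> S (max n (Suc m))" for r
    proof -
      have "r \<in> S n" "r \<in> S (Suc m)"
        using that antimono[of n "max n (Suc m)"] antimono[of "Suc m" "max n (Suc m)"] by auto
      then show ?thesis using n decided[of r m x] m insert.prems by auto
    qed
    then show ?case by blast
  qed
  have q: "q \<subseteq> C" unfolding q_def by blast
  have near: "\<exists>r\<in>T. r \<inter> F = q \<inter> F" if "finite F" "F \<subseteq> C" for F
  proof -
    obtain n where n: "\<forall>r\<in>S n. r \<inter> F = q \<inter> F" using eventually \<open>finite F\<close> \<open>F \<subseteq> C\<close> by metis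
    obtain r where r: "r \<in> S n" using nonempty by blast
    show ?thesis
    proof
      show "r \<in> T" using r S(1) by (rule set_rev_mp)
      show "r \<inter> F = q \<inter> F" using n r by (rule bspec)
    qed
  qed
  have "\<exists>F. finite F \<and> F \<subseteq> C \<and>
      (\<forall>r\<in>T. \<forall>r'\<in>T. r \<inter> F = q \<inter> F \<longrightarrow> r' \<inter> F = q \<inter> F \<longrightarrow> f r = f r')"
    using q near by (rule locally_constant)
  then obtain F where F: "finite F" "F \<subseteq> C"
    and const: "\<forall>r\<in>T. \<forall>r'\<in>T. r \<inter> F = q \<inter> F \<longrightarrow> r' \<inter> F = q \<inter> F \<longrightarrow> f r = f r'"
    by (elim exE conjE)
  \<comment> \<open>A whole stage \<open>S n\<close> agrees with \<open>q\<close> on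
    \<open>F\<close>, so \<open>f\<close> is constant on it, although its image is infinite by
    construction.\<close>
  obtain n where n: "\<forall>r\<in>S n. r \<inter> F = q \<inter> F" using eventually[OF F] by blast
  obtain r0 where "r0 \<in> S n" using nonempty by blast
  have "f r = f r0" if "r \<in> S n" for r
  proof (rule const[rule_format])
    show "r \<in> T" "r0 \<in> T" using that \<open>r0 \<in> S n\<close> S(1) by (meson subsetD)+
    show "r \<inter> F = q \<inter> F" "r0 \<inter> F = q \<inter> F" using n that \<open>r0 \<in> S n\<close> by (meson bspec)+
  qed
  then have "f ` S n \<subseteq> {f r0}" by auto
  then show False using S(2) by (meson finite.emptyI finite_insert finite_subset)
qed

subsection \<open>Admissible orderings and leading exponents\<close>

lemma X_pow_eq_iff: "(X_pow u :: 'k::field mpoly) = X_pow v \<longleftrightarrow> u = v"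
  unfolding X_pow_def by (metis keys_single one_neq_zero singleton_inject)

lemma keys_X_pow: "Poly_Mapping.keys (X_pow u :: 'k::field mpoly) = {u}"
  by (simp add: X_pow_def)

lemma X_pow_add: "(X_pow (u + v) :: 'k::field mpoly) = X_pow u * X_pow v"
  by (simp add: X_pow_def mult_single)

lemma X_pow_zero: "(X_pow 0 :: 'k::field mpoly) = 1"
  by (simp add: X_pow_def)

section \<open>The canonical basis indexed by exponents\<close>

context countable_type_algebra
begin

text \<open>Indexing by exponents turns conditions on orderings of the canonical basis into
  conditions on sums of exponents. The value is meaningful only for \<open>u\<close> in
  \<open>exponents t\<close>.\<close>

definition basis_elt :: "(nat \<Rightarrow>\<^sub>0 nat) \<Rightarrow> 'a" where
  "basis_elt u = inv_into UNIV \<Phi> (X_pow u)"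

text \<open>Exponents replace monomials so that Dickson's lemma applies directly. The description is
  unique for admissible \<open>r\<close> and nonzero \<open>a\<close>.\<close>

definition leading_exponent :: "'a rel \<Rightarrow> 'a \<Rightarrow> (nat \<Rightarrow>\<^sub>0 nat)" where
  "leading_exponent r a = (THE u. u \<in> Poly_Mapping.keys (\<Phi> a) \<and>
     (\<forall>v\<in>Poly_Mapping.keys (\<Phi> a). (basis_elt v, basis_elt u) \<in> r))"

text \<open>This set determines the ideal of leading monomials, so finiteness is shown for such sets
  first.\<close>

definition leading_exponents :: "'a rel \<Rightarrow> 'a set \<Rightarrow> (nat \<Rightarrow>\<^sub>0 nat) set" where
  "leading_exponents r H = leading_exponent r ` (H - {0})"

lemma Phi_eq_iff: "\<Phi> x = \<Phi> y \<longleftrightarrow> x = y"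
  using bij_Phi by (auto simp: bij_betw_def dest: injD)

lemma keys_Phi: "Poly_Mapping.keys (\<Phi> x) \<subseteq> exponents t"
  using bij_Phi by (auto simp: bij_betw_def polys_def)

lemma lookup_Phi_add_scale:
  "Poly_Mapping.lookup (\<Phi> (x + scale c y)) v =
   Poly_Mapping.lookup (\<Phi> x) v + c * Poly_Mapping.lookup (\<Phi> y) v"
proof -
  interpret Vector_Spaces.linear scale poly_scale \<Phi> by (rule linear_Phi)
  show ?thesis by (simp add: add scale lookup_add lookup_poly_scale)
qed

lemma Phi_eq_0_iff: "\<Phi> x = 0 \<longleftrightarrow> x = 0"
proof -
  interpret Vector_Spaces.linear scale poly_scale \<Phi> by (rule linear_Phi)
  show ?thesis using Phi_eq_iff[of x 0] by (simp add: zero)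
qed

lemma Phi_basis_elt:
  assumes "u \<in> exponents t"
  shows "\<Phi> (basis_elt u) = X_pow u"
proof -
  have "X_pow u \<in> (polys t :: 'k mpoly set)" using assms by (simp add: polys_def keys_X_pow)
  then show ?thesis unfolding basis_elt_def by (rule bij_betw_inv_into_right[OF bij_Phi])
qed

lemma basis_elt_eq_iff:
  "u \<in> exponents t \<Longrightarrow> v \<in> exponents t \<Longrightarrow> basis_elt u = basis_elt v \<longleftrightarrow> u = v"
  using Phi_basis_elt X_pow_eq_iff by metis

lemma basis_elt_nonzero: "u \<in> exponents t \<Longrightarrow> basis_elt u \<noteq> 0"
  using Phi_basis_elt[of u] Phi_eq_0_iff[of "basis_elt u"] keys_X_pow[of u, where 'k = 'k] by auto

lemma canonical_basis_eq: "canonical_basis t \<Phi> = basis_elt ` exponents t"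
proof (intro equalityI subsetI)
  fix x
  assume "x \<in> canonical_basis t \<Phi>"
  then obtain u where "u \<in> exponents t" "\<Phi> x = X_pow u"
    unfolding canonical_basis_def monomials_def by auto
  then show "x \<in> basis_elt ` exponents t" using Phi_basis_elt Phi_eq_iff by (metis imageI)
next
  fix x
  assume "x \<in> basis_elt ` exponents t"
  then show "x \<in> canonical_basis t \<Phi>"
    unfolding canonical_basis_def monomials_def using Phi_basis_elt by auto
qed

lemma countable_canonical_basis: "countable (canonical_basis t \<Phi>)"
  unfolding canonical_basis_eq using countable_exponents by blast

section \<open>Admissible orderings in terms of exponents\<close>

lemma transfer_order_Phi_iff: "(\<Phi> x, \<Phi> y) \<in> transfer_order \<Phi> r \<longleftrightarrow> (x, y) \<in> r"
  unfolding transfer_order_def using Phi_eq_iff by auto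

lemma transfer_order_X_pow_iff:
  "u \<in> exponents t \<Longrightarrow> v \<in> exponents t \<Longrightarrow>
   (X_pow u, X_pow v) \<in> transfer_order \<Phi> r \<longleftrightarrow> (basis_elt u, basis_elt v) \<in> r"
  using Phi_basis_elt transfer_order_Phi_iff by metis

lemma linear_order_on_transfer_order:
  assumes "linear_order_on (canonical_basis t \<Phi>) r"
  shows "linear_order_on (monomials t) (transfer_order \<Phi> r)"
proof -
  have N: "r \<subseteq> canonical_basis t \<Phi> \<times> canonical_basis t \<Phi>" "refl_on (canonical_basis t \<Phi>) r"
    "trans r" "antisym r" "total_on (canonical_basis t \<Phi>) r"
    using assms unfolding order_on_defs by auto
  have M: "monomials t = \<Phi> ` canonical_basis t \<Phi>"
    unfolding canonical_basis_eq monomials_def by (force simp: Phi_basis_elt image_image)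
  have "transfer_order \<Phi> r \<subseteq> monomials t \<times> monomials t"
    unfolding M transfer_order_def using N(1) by auto
  moreover have "refl_on (monomials t) (transfer_order \<Phi> r)"
    using N(2) unfolding M refl_on_def by (auto simp: transfer_order_Phi_iff)
  moreover have "trans (transfer_order \<Phi> r)"
    unfolding transfer_order_def using N(3) by (auto intro!: transI simp: Phi_eq_iff dest: transD)
  moreover have "antisym (transfer_order \<Phi> r)"
    unfolding transfer_order_def using N(4) by (auto intro!: antisymI simp: Phi_eq_iff dest: antisymD)
  moreover have "total_on (monomials t) (transfer_order \<Phi> r)"
    using N(5) unfolding M total_on_def by (auto simp: transfer_order_Phi_iff)
  ultimately show ?thesis unfolding order_on_defs by blast
qed

text \<open>The axioms move from monomials to \<open>basis_elt\<close>. Linearity of the transferred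
  relation follows because \<Phi> maps the canonical basis bijectively to the monomials.\<close>

lemma AO_iff:
  "r \<in> AO t \<Phi> \<longleftrightarrow> linear_order_on (canonical_basis t \<Phi>) r \<and>
     (\<forall>v\<in>exponents t. (basis_elt 0, basis_elt v) \<in> r) \<and>
     (\<forall>u\<in>exponents t. \<forall>v\<in>exponents t. \<forall>w\<in>exponents t.
        (basis_elt u, basis_elt v) \<in> r \<longrightarrow> (basis_elt (u + w), basis_elt (v + w)) \<in> r)"
  unfolding AO_def AO_monomials_def TO_def
  by (auto simp: linear_order_on_transfer_order transfer_order_X_pow_iff exponents_add
        zero_in_exponents simp flip: X_pow_zero)

lemma AO_linear_order: "r \<in> AO t \<Phi> \<Longrightarrow> linear_order_on (canonical_basis t \<Phi>) r"
  using AO_iff by blast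

lemma AO_antisym:
  "\<lbrakk>r \<in> AO t \<Phi>; u \<in> exponents t; v \<in> exponents t;
    (basis_elt u, basis_elt v) \<in> r; (basis_elt v, basis_elt u) \<in> r\<rbrakk> \<Longrightarrow> u = v"
  using AO_linear_order basis_elt_eq_iff unfolding order_on_defs by (metis antisymD)

lemma AO_trans: "\<lbrakk>r \<in> AO t \<Phi>; (x, y) \<in> r; (y, z) \<in> r\<rbrakk> \<Longrightarrow> (x, z) \<in> r"
  using AO_linear_order unfolding order_on_defs by (metis transD)

lemma AO_refl: "\<lbrakk>r \<in> AO t \<Phi>; u \<in> exponents t\<rbrakk> \<Longrightarrow> (basis_elt u, basis_elt u) \<in> r"
  using AO_linear_order canonical_basis_eq unfolding order_on_defs refl_on_def by auto

lemma AO_le_add: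
  assumes "r \<in> AO t \<Phi>" "u \<in> exponents t" "w \<in> exponents t"
  shows "(basis_elt u, basis_elt (u + w)) \<in> r"
proof -
  have "(basis_elt (0 + u), basis_elt (w + u)) \<in> r"
    using assms AO_iff zero_in_exponents by blast
  then show ?thesis by (simp add: add.commute)
qed

text \<open>By Dickson's lemma, an infinite descending chain has \<open>i < j\<close> with
  \<open>f j\<close> a multiple of \<open>f i\<close>, hence above it; but the chain has strictly
  descended from \<open>f i\<close> to \<open>f (Suc i)\<close> and stays below.\<close>

lemma wf_AO:
  assumes "r \<in> AO t \<Phi>"
  shows "wf {(u, v). u \<in> exponents t \<and> v \<in> exponents t \<and> u \<noteq> v \<and> (basis_elt u, basis_elt v) \<in> r}"
  unfolding wf_iff_no_infinite_down_chain
proof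
  assume "\<exists>f. \<forall>i :: nat. (f (Suc i), f i) \<in>
    {(u, v). u \<in> exponents t \<and> v \<in> exponents t \<and> u \<noteq> v \<and> (basis_elt u, basis_elt v) \<in> r}"
  then obtain f where f: "\<And>i :: nat. f i \<in> exponents t" "\<And>i. f (Suc i) \<noteq> f i"
    "\<And>i. (basis_elt (f (Suc i)), basis_elt (f i)) \<in> r" by blast
  obtain i j w where ij: "i < j" "w \<in> exponents t" "f j = f i + w"
    using dickson_good_pair[of f t] f(1) by blast
  \<comment> \<open>The descent starts at \<open>Suc i\<close>, leaving the strict step from
    \<open>f i\<close> to \<open>f (Suc i)\<close> to be contradicted.\<close>
  have "(basis_elt (f k), basis_elt (f (Suc i))) \<in> r" if "Suc i \<le> k" for k
    using that
  proof (induction k rule: dec_induct)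
    case base
    then show ?case using AO_refl assms f(1) by blast
  next
    case (step k)
    then show ?case using AO_trans[OF assms f(3)] by blast
  qed
  then have "(basis_elt (f j), basis_elt (f (Suc i))) \<in> r" using ij(1) by simp
  moreover have "(basis_elt (f i), basis_elt (f j)) \<in> r"
    using AO_le_add[OF assms f(1) ij(2)] ij(3) by simp
  ultimately have "(basis_elt (f i), basis_elt (f (Suc i))) \<in> r" using AO_trans assms by blast
  then show False using AO_antisym[OF assms f(1) f(1) _ f(3)] f(2) by metis
qed

section \<open>Leading exponents and leading monomials\<close>

lemma leading_exponent_eqI:
  assumes "r \<in> AO t \<Phi>" "u \<in> Poly_Mapping.keys (\<Phi> a)"
    and "\<And>v. v \<in> Poly_Mapping.keys (\<Phi> a) \<Longrightarrow> (basis_elt v, basis_elt u) \<in> r"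
  shows "leading_exponent r a = u"
  unfolding leading_exponent_def
proof (rule the_equality)
  show "u' = u" if "u' \<in> Poly_Mapping.keys (\<Phi> a) \<and>
     (\<forall>v\<in>Poly_Mapping.keys (\<Phi> a). (basis_elt v, basis_elt u') \<in> r)" for u'
    using that assms keys_Phi[of a] by (intro AO_antisym[OF assms(1)]) auto
qed (use assms in blast)

lemma AO_max:
  assumes "r \<in> AO t \<Phi>" "finite X" "X \<noteq> {}" "X \<subseteq> exponents t"
  obtains u where "u \<in> X" "\<And>v. v \<in> X \<Longrightarrow> (basis_elt v, basis_elt u) \<in> r"
proof -
  have "\<exists>m\<in>basis_elt ` X. \<forall>x\<in>basis_elt ` X. (x, m) \<in> r"
    by (rule finite_linear_order_max[OF AO_linear_order[OF assms(1)]])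
      (use assms canonical_basis_eq in auto)
  then show ?thesis using that by auto
qed

lemma
  assumes "r \<in> AO t \<Phi>" "a \<noteq> 0"
  shows leading_exponent_in_keys: "leading_exponent r a \<in> Poly_Mapping.keys (\<Phi> a)"
    and le_leading_exponent:
      "v \<in> Poly_Mapping.keys (\<Phi> a) \<Longrightarrow> (basis_elt v, basis_elt (leading_exponent r a)) \<in> r"
proof -
  have "Poly_Mapping.keys (\<Phi> a) \<noteq> {}" using assms(2) Phi_eq_0_iff by simp
  then obtain u where u: "u \<in> Poly_Mapping.keys (\<Phi> a)"
    "\<And>v. v \<in> Poly_Mapping.keys (\<Phi> a) \<Longrightarrow> (basis_elt v, basis_elt u) \<in> r"
    using AO_max[OF assms(1) finite_keys _ keys_Phi] by blast
  then have "leading_exponent r a = u" using leading_exponent_eqI assms(1) by blast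
  then show "leading_exponent r a \<in> Poly_Mapping.keys (\<Phi> a)"
    and "v \<in> Poly_Mapping.keys (\<Phi> a) \<Longrightarrow> (basis_elt v, basis_elt (leading_exponent r a)) \<in> r"
    using u by auto
qed

lemma leading_exponent_in_exponents:
  "r \<in> AO t \<Phi> \<Longrightarrow> a \<noteq> 0 \<Longrightarrow> leading_exponent r a \<in> exponents t"
  using leading_exponent_in_keys keys_Phi by blast

lemma LM_eq:
  assumes "r \<in> AO t \<Phi>" "a \<noteq> 0"
  shows "LM \<Phi> r a = X_pow (leading_exponent r a)"
  unfolding LM_def occurring_monomials_def
proof (rule the_equality)
  let ?u = "leading_exponent r a"
  have E: "v \<in> exponents t" if "v \<in> Poly_Mapping.keys (\<Phi> a)" for v using that keys_Phi by blast
  show "X_pow ?u \<in> X_pow ` Poly_Mapping.keys (\<Phi> a) \<and>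
    (\<forall>m'\<in>X_pow ` Poly_Mapping.keys (\<Phi> a). (m', X_pow ?u) \<in> transfer_order \<Phi> r)"
    using leading_exponent_in_keys[OF assms] le_leading_exponent[OF assms] E
    by (auto simp: transfer_order_X_pow_iff)
  show "m = X_pow ?u" if "m \<in> X_pow ` Poly_Mapping.keys (\<Phi> a) \<and>
    (\<forall>m'\<in>X_pow ` Poly_Mapping.keys (\<Phi> a). (m', m) \<in> transfer_order \<Phi> r)" (is ?max) for m
  proof -
    obtain u where u: "u \<in> Poly_Mapping.keys (\<Phi> a)" "m = X_pow u" using \<open>?max\<close> by blast
    have "(basis_elt v, basis_elt u) \<in> r" if v: "v \<in> Poly_Mapping.keys (\<Phi> a)" for v
      using \<open>?max\<close> u v E by (auto simp: transfer_order_X_pow_iff)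
    then show ?thesis using leading_exponent_eqI[OF assms(1) u(1)] u(2) by simp
  qed
qed

lemma LM_ideal_eq:
  assumes "r \<in> AO t \<Phi>"
  shows "LM_ideal t \<Phi> r H = genideal (poly_ring t) (X_pow ` leading_exponents r H)"
proof -
  have "LM \<Phi> r ` (H - {0}) = X_pow ` leading_exponents r H"
    unfolding leading_exponents_def image_image by (rule image_cong) (auto simp: LM_eq assms)
  then show ?thesis by (simp add: LM_ideal_def)
qed

text \<open>Since \<open>basis_elt w\<close> has leading exponent \<open>w\<close>, multiplicativity
  of \<open>LM\<close> becomes addition of exponents. Left multiplication by
  \<open>basis_elt w\<close> thus shifts leading exponents as a monomial would, although \<Phi> need
  not be multiplicative.\<close>

lemma
  assumes "r \<in> AO t \<Phi>" "multiplicative_on \<Phi> {r}" "g \<noteq> 0" "w \<in> exponents t"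
  shows basis_elt_mult_nonzero: "basis_elt w * g \<noteq> 0"
    and leading_exponent_basis_elt_mult:
      "leading_exponent r (basis_elt w * g) = leading_exponent r g + w"
proof -
  have w: "basis_elt w \<noteq> 0" using basis_elt_nonzero assms(4) by blast
  show nz: "basis_elt w * g \<noteq> 0" using assms(2,3) w unfolding multiplicative_on_def by blast
  have "leading_exponent r (basis_elt w) = w"
    by (rule leading_exponent_eqI)
      (use assms in \<open>auto simp: Phi_basis_elt keys_X_pow AO_refl\<close>)
  moreover have "LM \<Phi> r (basis_elt w * g) = LM \<Phi> r (basis_elt w) * LM \<Phi> r g"
    using assms(2,3) w unfolding multiplicative_on_def by blast
  ultimately have "(X_pow (leading_exponent r (basis_elt w * g)) :: 'k mpoly) =
      X_pow (w + leading_exponent r g)"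
    using LM_eq assms w nz by (simp add: X_pow_add)
  then show "leading_exponent r (basis_elt w * g) = leading_exponent r g + w"
    by (simp add: X_pow_eq_iff add.commute)
qed

text \<open>Scaling by \<open>c\<close> is left multiplication by \<open>scale c 1\<close>, so a
  left ideal is a subspace.\<close>

lemma left_ideal_add_scale:
  assumes "left_ideal L" "x \<in> L" "y \<in> L"
  shows "x + scale c y \<in> L"
proof -
  have "scale c y = scale c 1 * y" using scale_mult_left[of c 1 y] by simp
  then show ?thesis using assms unfolding left_ideal_def by metis
qed

subsection \<open>Finiteness\<close>

text \<open>
  If an element \<open>h\<close> of \<open>L\<close> had \<open>r'\<close>-leading exponent \<open>m\<close> outside of the set \<open>V\<close> for \<open>r\<close>, then reducing
  \<open>h\<close> modulo \<open>G\<close> along \<open>r'\<close> would keep \<open>m\<close> and finally remove all exponents in \<open>V\<close>; but the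
  \<open>r\<close>-leading exponent of the resulting nonzero element of \<open>L\<close> lies in \<open>V\<close>.
\<close>

lemma leading_exponents_subset_of_groebner_basis:
  assumes "left_ideal L" and r: "r \<in> AO t \<Phi>" and r': "r' \<in> AO t \<Phi>" "multiplicative_on \<Phi> {r'}"
    and G: "G \<subseteq> L - {0}"
    and span: "\<And>v. v \<in> leading_exponents r L \<Longrightarrow> \<exists>g\<in>G. \<exists>w\<in>exponents t. v = leading_exponent r' g + w"
  shows "leading_exponents r' L \<subseteq> leading_exponents r L"
proof (rule ccontr)
  let ?V = "leading_exponents r L"
  assume "\<not> leading_exponents r' L \<subseteq> ?V"
  then obtain m where m: "m \<in> leading_exponents r' L" "m \<notin> ?V" by blast
  define S where "S = {h \<in> L. h \<noteq> 0 \<and> leading_exponent r' h = m}"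
  \<comment> \<open>The \<open>r\<close>-leading exponent witnesses that no element of
    \<open>S\<close> ever runs out of exponents in \<open>?V\<close>.\<close>
  have mem: "leading_exponent r h \<in> Poly_Mapping.keys (\<Phi> h) \<inter> ?V" if "h \<in> S" for h
    using that leading_exponent_in_keys[OF r] unfolding S_def leading_exponents_def by auto
  \<comment> \<open>Well-founded induction on the \<open>r'\<close>-largest exponent
    \<open>u\<close> of \<open>h\<close> in \<open>?V\<close>: each reduction gives an element of
    \<open>S\<close> for which this exponent is strictly smaller.\<close>
  have False if "h \<in> S" "u \<in> Poly_Mapping.keys (\<Phi> h) \<inter> ?V"
    "\<forall>v \<in> Poly_Mapping.keys (\<Phi> h) \<inter> ?V. (basis_elt v, basis_elt u) \<in> r'" for u h
    using that
  proof (induction u arbitrary: h rule: wf_induct_rule[OF wf_AO[OF r'(1)]])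
    case (1 u h)
    have h: "h \<in> L" "h \<noteq> 0" "leading_exponent r' h = m" using 1(2) unfolding S_def by auto
    have uE: "u \<in> exponents t" using 1(3) keys_Phi by blast
    obtain g w where g: "g \<in> G" "w \<in> exponents t" "u = leading_exponent r' g + w"
      using 1(3) span by blast
    \<comment> \<open>A left multiple of \<open>g\<close> whose \<open>r'\<close>-leading exponent
      is exactly \<open>u\<close>.\<close>
    define p where "p = basis_elt w * g"
    have "g \<noteq> 0" using G g(1) by blast
    then have p: "p \<in> L" "p \<noteq> 0" "leading_exponent r' p = u"
      using assms(1) G g basis_elt_mult_nonzero[OF r' _ g(2)]
        leading_exponent_basis_elt_mult[OF r' _ g(2)]
      unfolding p_def left_ideal_def by auto
    have p_le: "(basis_elt v, basis_elt u) \<in> r'" if "v \<in> Poly_Mapping.keys (\<Phi> p)" for v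
      using le_leading_exponent[OF r'(1) p(2) that] p(3) by simp
    have u_key: "u \<in> Poly_Mapping.keys (\<Phi> p)" using leading_exponent_in_keys[OF r'(1) p(2)] p(3) by simp
    have h_le: "(basis_elt v, basis_elt m) \<in> r'" if "v \<in> Poly_Mapping.keys (\<Phi> h)" for v
      using le_leading_exponent[OF r'(1) h(2) that] h(3) by simp
    have m_key: "m \<in> Poly_Mapping.keys (\<Phi> h)" using leading_exponent_in_keys[OF r'(1) h(2)] h(3) by simp
    have mE: "m \<in> exponents t" using m_key keys_Phi by blast
    \<comment> \<open>As \<open>u\<close> lies in \<open>?V\<close> and \<open>m\<close> does not,
      \<open>u\<close> is strictly below \<open>m\<close>. So \<open>m\<close> does not occur in
      \<open>p\<close>, and the reduction leaves its coefficient alone.\<close>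
    have um: "u \<noteq> m" "(basis_elt u, basis_elt m) \<in> r'" using 1(3) m(2) h_le by auto
    have m_not: "m \<notin> Poly_Mapping.keys (\<Phi> p)"
      using um p_le AO_antisym[OF r'(1) uE mE] by blast
    \<comment> \<open>Chosen to cancel the coefficient at \<open>u\<close>.\<close>
    define c where "c = - Poly_Mapping.lookup (\<Phi> h) u / Poly_Mapping.lookup (\<Phi> p) u"
    define h' where "h' = h + scale c p"
    have look: "Poly_Mapping.lookup (\<Phi> h') v =
        Poly_Mapping.lookup (\<Phi> h) v + c * Poly_Mapping.lookup (\<Phi> p) v" for v
      unfolding h'_def by (rule lookup_Phi_add_scale)
    have keys': "Poly_Mapping.keys (\<Phi> h') \<subseteq> Poly_Mapping.keys (\<Phi> h) \<union> Poly_Mapping.keys (\<Phi> p)"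
      by (auto simp: in_keys_iff look)
    have "Poly_Mapping.lookup (\<Phi> p) u \<noteq> 0" using u_key by (simp add: in_keys_iff)
    then have u_not: "u \<notin> Poly_Mapping.keys (\<Phi> h')"
      by (simp add: in_keys_iff look c_def)
    have m_key': "m \<in> Poly_Mapping.keys (\<Phi> h')"
      using m_key m_not by (simp add: in_keys_iff look)
    have "leading_exponent r' h' = m"
      by (rule leading_exponent_eqI[OF r'(1) m_key'])
        (use keys' h_le p_le um(2) AO_trans[OF r'(1)] in blast)
    moreover have "h' \<in> L" unfolding h'_def using left_ideal_add_scale assms(1) h(1) p(1) by blast
    moreover have "h' \<noteq> 0" using m_key' Phi_eq_0_iff[of h'] by auto
    ultimately have h'S: "h' \<in> S" unfolding S_def by blast
    let ?X = "Poly_Mapping.keys (\<Phi> h') \<inter> ?V"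
    have "?X \<noteq> {}" using mem[OF h'S] by blast
    moreover have "?X \<subseteq> exponents t" using keys_Phi by blast
    moreover have "finite ?X" by simp
    ultimately obtain u' where u': "u' \<in> ?X" "\<And>v. v \<in> ?X \<Longrightarrow> (basis_elt v, basis_elt u') \<in> r'"
      using AO_max[OF r'(1)] by metis
    \<comment> \<open>An exponent of \<open>h'\<close> in \<open>?V\<close> comes from
      \<open>h\<close>, where \<open>u\<close> is the largest one in \<open>?V\<close>, or from
      \<open>p\<close>, where \<open>u\<close> leads.\<close>
    have "(basis_elt u', basis_elt u) \<in> r'" using u'(1) keys' p_le 1(4) by blast
    moreover have "u' \<noteq> u" "u' \<in> exponents t" using u'(1) u_not keys_Phi by blast+
    ultimately show False using 1(1)[of u' h'] uE h'S u' by blast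
  qed
  moreover obtain h where h: "h \<in> S" using m(1) unfolding S_def leading_exponents_def by auto
  moreover obtain u where "u \<in> Poly_Mapping.keys (\<Phi> h) \<inter> ?V"
    "\<And>v. v \<in> Poly_Mapping.keys (\<Phi> h) \<inter> ?V \<Longrightarrow> (basis_elt v, basis_elt u) \<in> r'"
    using AO_max[OF r'(1), of "Poly_Mapping.keys (\<Phi> h) \<inter> ?V"] mem[OF h] keys_Phi[of h]
    by (metis empty_iff finite_Int finite_keys le_infI1)
  ultimately show False by blast
qed

text \<open>Dickson's lemma gives a finite \<open>G\<close> in \<open>L\<close> whose
  \<open>r\<close>-leading exponents generate all others, and \<open>F\<close> contains all pairs of
  basis elements occurring in \<open>G\<close>. Agreement on \<open>F\<close> keeps the leading
  exponents of \<open>G\<close>. Multiplicativity is asked of \<open>r'\<close>, so that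
  \<open>r\<close> may be any admissible limit.\<close>

lemma leading_exponents_locally_constant:
  assumes "left_ideal L" and r: "r \<in> AO t \<Phi>"
  shows "\<exists>F. finite F \<and> F \<subseteq> canonical_basis t \<Phi> \<times> canonical_basis t \<Phi> \<and>
    (\<forall>r'\<in>AO t \<Phi>. multiplicative_on \<Phi> {r'} \<longrightarrow> r' \<inter> F = r \<inter> F \<longrightarrow>
       leading_exponents r' L = leading_exponents r L)"
proof -
  have "leading_exponents r L \<subseteq> exponents t"
    unfolding leading_exponents_def using leading_exponent_in_exponents[OF r] by auto
  then obtain U where U: "finite U" "U \<subseteq> leading_exponents r L"
    "\<And>v. v \<in> leading_exponents r L \<Longrightarrow> \<exists>u\<in>U. \<exists>w\<in>exponents t. v = u + w"
    using dickson_finite_basis by metis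
  then obtain G where G: "G \<subseteq> L - {0}" "finite G" "U = leading_exponent r ` G"
    unfolding leading_exponents_def by (meson finite_subset_image)
  define B where "B = (\<Union>g\<in>G. basis_elt ` Poly_Mapping.keys (\<Phi> g))"
  have "finite (B \<times> B)" unfolding B_def using G(2) by simp
  moreover have "B \<subseteq> canonical_basis t \<Phi>"
    unfolding B_def canonical_basis_eq using keys_Phi by blast
  moreover have "leading_exponents r' L = leading_exponents r L"
    if r': "r' \<in> AO t \<Phi>" "multiplicative_on \<Phi> {r'}" and agree: "r' \<inter> (B \<times> B) = r \<inter> (B \<times> B)" for r'
  proof
    have same: "leading_exponent r' g = leading_exponent r g" if g: "g \<in> G" for g
    proof (rule leading_exponent_eqI[OF r'(1)])
      have "g \<noteq> 0" using G(1) g by blast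
      note lead = leading_exponent_in_keys[OF r this] le_leading_exponent[OF r this]
      show "leading_exponent r g \<in> Poly_Mapping.keys (\<Phi> g)" by (rule lead)
      fix v
      assume v: "v \<in> Poly_Mapping.keys (\<Phi> g)"
      have "(basis_elt v, basis_elt (leading_exponent r g)) \<in> r \<inter> (B \<times> B)"
        using lead v g unfolding B_def by blast
      then show "(basis_elt v, basis_elt (leading_exponent r g)) \<in> r'" using agree by blast
    qed
    have span: "\<exists>g\<in>G. \<exists>w\<in>exponents t. v = leading_exponent r' g + w"
      if "v \<in> leading_exponents r L" for v
      using U(3)[OF that] G(3) same by auto
    then show "leading_exponents r' L \<subseteq> leading_exponents r L"
      using leading_exponents_subset_of_groebner_basis[OF assms(1) r r' G(1)] by blast
    \<comment> \<open>Left multiples of elements of \<open>G\<close> stay in \<open>L\<close> and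
      realize every exponent generated by \<open>G\<close>.\<close>
    show "leading_exponents r L \<subseteq> leading_exponents r' L"
    proof
      fix v
      assume "v \<in> leading_exponents r L"
      then obtain g w where g: "g \<in> G" "w \<in> exponents t" "v = leading_exponent r' g + w"
        using span by blast
      then have "g \<noteq> 0" "basis_elt w * g \<in> L" using G(1) assms(1) unfolding left_ideal_def by auto
      then show "v \<in> leading_exponents r' L"
        using basis_elt_mult_nonzero[OF r' _ g(2)] leading_exponent_basis_elt_mult[OF r' _ g(2)] g(3)
        unfolding leading_exponents_def by (metis Diff_iff image_eqI singletonD)
    qed
  qed
  ultimately show ?thesis by (intro exI[of _ "B \<times> B"]) blast
qed

text \<open>Each axiom of an admissible ordering involves at most three pairs at a time, so it can
  be tested on an admissible ordering agreeing with \<open>q\<close> on those pairs.\<close>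

lemma AO_limit:
  assumes q: "q \<subseteq> canonical_basis t \<Phi> \<times> canonical_basis t \<Phi>"
    and approx: "\<And>F. finite F \<Longrightarrow> F \<subseteq> canonical_basis t \<Phi> \<times> canonical_basis t \<Phi> \<Longrightarrow>
      \<exists>r\<in>AO t \<Phi>. r \<inter> F = q \<inter> F"
  shows "q \<in> AO t \<Phi>"
proof -
  let ?N = "canonical_basis t \<Phi>"
  have approx': "\<exists>r\<in>AO t \<Phi>. \<forall>p\<in>F. p \<in> r \<longleftrightarrow> p \<in> q" if "finite F" "F \<subseteq> ?N \<times> ?N" for F
    using approx[OF that] by blast
  have N: "basis_elt u \<in> ?N" if "u \<in> exponents t" for u using that canonical_basis_eq by blast
  have "refl_on ?N q"
    unfolding refl_on_def
  proof
    fix x assume "x \<in> ?N"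
    then show "(x, x) \<in> q"
      using approx'[of "{(x, x)}"] AO_linear_order unfolding order_on_defs refl_on_def by auto
  qed
  moreover have "trans q"
  proof (rule transI)
    fix x y z assume xyz: "(x, y) \<in> q" "(y, z) \<in> q"
    then have "x \<in> ?N" "y \<in> ?N" "z \<in> ?N" using q by auto
    then obtain r where r: "r \<in> AO t \<Phi>" "\<forall>p\<in>{(x, y), (y, z), (x, z)}. p \<in> r \<longleftrightarrow> p \<in> q"
      using approx'[of "{(x, y), (y, z), (x, z)}"] by auto
    then have "(x, z) \<in> r" using xyz by (intro AO_trans[OF r(1), of x y z]) simp_all
    then show "(x, z) \<in> q" using r(2) by simp
  qed
  moreover have "antisym q"
  proof (rule antisymI)
    fix x y assume xy: "(x, y) \<in> q" "(y, x) \<in> q"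
    then have "{(x, y), (y, x)} \<subseteq> ?N \<times> ?N" using q by auto
    then obtain r where "r \<in> AO t \<Phi>" "(x, y) \<in> r" "(y, x) \<in> r"
      using approx'[of "{(x, y), (y, x)}"] xy by auto
    then show "x = y" using AO_linear_order unfolding order_on_defs by (metis antisymD)
  qed
  moreover have "total_on ?N q"
  proof (rule total_onI)
    fix x y assume xy: "x \<in> ?N" "y \<in> ?N" "x \<noteq> y"
    then obtain r where "r \<in> AO t \<Phi>" "(x, y) \<in> r \<longleftrightarrow> (x, y) \<in> q" "(y, x) \<in> r \<longleftrightarrow> (y, x) \<in> q"
      using approx'[of "{(x, y), (y, x)}"] by auto
    then show "(x, y) \<in> q \<or> (y, x) \<in> q"
      using AO_linear_order xy unfolding order_on_defs total_on_def by metis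
  qed
  moreover have "(basis_elt 0, basis_elt v) \<in> q" if "v \<in> exponents t" for v
    using approx'[of "{(basis_elt 0, basis_elt v)}"] that N zero_in_exponents AO_iff by auto
  moreover have "(basis_elt (u + w), basis_elt (v + w)) \<in> q"
    if uvw: "u \<in> exponents t" "v \<in> exponents t" "w \<in> exponents t"
      and uv: "(basis_elt u, basis_elt v) \<in> q" for u v w
  proof -
    have "{(basis_elt u, basis_elt v), (basis_elt (u + w), basis_elt (v + w))} \<subseteq> ?N \<times> ?N"
      using uvw N exponents_add by auto
    then obtain r where r: "r \<in> AO t \<Phi>" "(basis_elt u, basis_elt v) \<in> r"
      "(basis_elt (u + w), basis_elt (v + w)) \<in> r \<longleftrightarrow> (basis_elt (u + w), basis_elt (v + w)) \<in> q"
      using approx'[of "{(basis_elt u, basis_elt v), (basis_elt (u + w), basis_elt (v + w))}"] uv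
      by auto
    then show ?thesis using uvw AO_iff by blast
  qed
  ultimately show ?thesis using q unfolding AO_iff order_on_defs by blast
qed

text \<open>The order \<le> on finitely supported functions is lexicographic, which gives an
  admissible ordering on exponents.\<close>

lemma AO_nonempty: "AO t \<Phi> \<noteq> {}"
proof -
  define r where "r = {(basis_elt u, basis_elt v) | u v. u \<in> exponents t \<and> v \<in> exponents t \<and> u \<le> v}"
  have r_iff: "(basis_elt u, basis_elt v) \<in> r \<longleftrightarrow> u \<le> v"
    if "u \<in> exponents t" "v \<in> exponents t" for u v
    using that basis_elt_eq_iff unfolding r_def by auto
  have zero_le: "0 \<le> v" for v :: "nat \<Rightarrow>\<^sub>0 nat"
  proof (rule ccontr)
    assume "\<not> 0 \<le> v"
    then have "v < 0" by simp
    \<comment> \<open>Lexicographically, \<open>v < 0\<close> would require a natural number below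
      zero at the first difference.\<close>
    then show False by transfer (auto simp: less_fun_def)
  qed
  have "r \<subseteq> canonical_basis t \<Phi> \<times> canonical_basis t \<Phi>" unfolding r_def canonical_basis_eq by blast
  moreover have "refl_on (canonical_basis t \<Phi>) r"
    unfolding refl_on_def canonical_basis_eq by (auto simp: r_iff)
  moreover have "trans r"
  proof (rule transI)
    fix x y z
    assume "(x, y) \<in> r" "(y, z) \<in> r"
    then obtain u v v' w where "x = basis_elt u" "y = basis_elt v" "y = basis_elt v'" "z = basis_elt w"
      "u \<in> exponents t" "v \<in> exponents t" "v' \<in> exponents t" "w \<in> exponents t" "u \<le> v" "v' \<le> w"
      unfolding r_def by auto
    then show "(x, z) \<in> r" using basis_elt_eq_iff[of v v'] r_iff[of u w] by auto
  qed
  moreover have "antisym r"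
    unfolding r_def by (rule antisymI) (auto simp: basis_elt_eq_iff)
  moreover have "total_on (canonical_basis t \<Phi>) r"
    unfolding total_on_def canonical_basis_eq by (auto simp: r_iff)
  ultimately have "r \<in> AO t \<Phi>"
    unfolding AO_iff order_on_defs
    by (auto simp: r_iff zero_le exponents_add zero_in_exponents add_right_mono)
  then show ?thesis by blast
qed

text \<open>The compactness principle is applied to relations on the canonical basis. A limit
  \<open>q\<close> is admissible by \<open>AO_limit\<close>, and near it all sets of leading
  exponents equal that of \<open>q\<close>. The ideals are images of these finitely many
  sets.\<close>

lemma finite_LM_ideals:
  assumes "left_ideal L" "\<TT> \<subseteq> AO t \<Phi>"
    and mult: "multiplicative_on \<Phi> \<TT>"
  shows "finite {LM_ideal t \<Phi> r L | r. r \<in> \<TT>}"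
proof -
  let ?N = "canonical_basis t \<Phi>"
  have mult1: "multiplicative_on \<Phi> {r}" if "r \<in> \<TT>" for r
    using mult that unfolding multiplicative_on_def by blast
  have "finite ((\<lambda>r. leading_exponents r L) ` \<TT>)"
  proof (rule finite_image_if_locally_constant_at_limits[of "?N \<times> ?N"])
    show "countable (?N \<times> ?N)" using countable_canonical_basis by simp
  next
    fix q
    assume q: "q \<subseteq> ?N \<times> ?N"
      and approx: "\<And>F. finite F \<Longrightarrow> F \<subseteq> ?N \<times> ?N \<Longrightarrow> \<exists>r\<in>\<TT>. r \<inter> F = q \<inter> F"
    have "\<exists>r\<in>AO t \<Phi>. r \<inter> F = q \<inter> F" if "finite F" "F \<subseteq> ?N \<times> ?N" for F
      using approx[OF that] assms(2) by blast
    then have qAO: "q \<in> AO t \<Phi>" using AO_limit q by blast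
    obtain F where F: "finite F" "F \<subseteq> ?N \<times> ?N"
      "\<And>r'. r' \<in> AO t \<Phi> \<Longrightarrow> multiplicative_on \<Phi> {r'} \<Longrightarrow> r' \<inter> F = q \<inter> F \<Longrightarrow>
         leading_exponents r' L = leading_exponents q L"
      using leading_exponents_locally_constant[OF assms(1) qAO] by auto
    have const: "leading_exponents r L = leading_exponents q L" if "r \<in> \<TT>" "r \<inter> F = q \<inter> F" for r
      using F(3)[of r] that mult1 subsetD[OF assms(2)] by simp
    show "\<exists>F. finite F \<and> F \<subseteq> ?N \<times> ?N \<and> (\<forall>r\<in>\<TT>. \<forall>r'\<in>\<TT>. r \<inter> F = q \<inter> F \<longrightarrow>
        r' \<inter> F = q \<inter> F \<longrightarrow> leading_exponents r L = leading_exponents r' L)"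
      by (intro exI[of _ F] conjI ballI impI F(1,2)) (simp only: const)
  qed
  then have "finite ((\<lambda>V. genideal (poly_ring t) (X_pow ` V) :: 'k mpoly set) `
      (\<lambda>r. leading_exponents r L) ` \<TT>)"
    by (rule finite_imageI)
  moreover have "{LM_ideal t \<Phi> r L | r. r \<in> \<TT>} \<subseteq>
      (\<lambda>V. genideal (poly_ring t) (X_pow ` V)) ` (\<lambda>r. leading_exponents r L) ` \<TT>"
    using LM_ideal_eq assms(2) by blast
  ultimately show ?thesis by (rule rev_finite_subset)
qed

end

theorem theorem8p4:
  fixes scale :: "'k::field \<Rightarrow> 'a::ring_1 \<Rightarrow> 'a"
    and t :: nat
    and \<Phi> :: "'a \<Rightarrow> 'k mpoly"
    and L :: "'a set"
  assumes "countable_type_algebra scale t \<Phi>"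
    and "left_ideal L"
  shows "(\<forall>\<TT> \<subseteq> AO t \<Phi>.
            closedin (subtopology (TO_topology (canonical_basis t \<Phi>)) (AO t \<Phi>)) \<TT> \<longrightarrow>
            multiplicative_on \<Phi> \<TT> \<longrightarrow>
            finite {LM_ideal t \<Phi> r L | r. r \<in> \<TT>}) \<and>
         (multiplicative_on \<Phi> (AO t \<Phi>) \<longrightarrow>
            {LM_ideal t \<Phi> r L | r. r \<in> AO t \<Phi>} \<noteq> {} \<and>
            finite {LM_ideal t \<Phi> r L | r. r \<in> AO t \<Phi>})"
proof -
  interpret countable_type_algebra scale t \<Phi> by (rule assms(1))
  show ?thesis using finite_LM_ideals[OF assms(2)] AO_nonempty by auto
qed

end
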